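(* Suppose $X$ has a $d$-dimensional elliptical distribution ($d\ge2$) with partial correlations $\rho_{ij\cdot V\setminus\{i,j\}}\ge 0$ for all $i\neq j$, and suppose $X$ admits a twice differentiable density function with strictly positive density generator $\varphi_d(t)$, $t\ge 0$. Let $\rho_*=\min_{i\ne j}\rho_{ij\cdot V\setminus\{i,j\}}$ and $\phi(t)=\log\varphi_d(t)$. Then $X$ is $\mathrm{MTP}_2$ if and only if the following three conditions hold: (i) $\phi'(t)\le 0$ for all $t\ge 0$; (ii) for all $t>0$, $\phi'(t)=0$ implies $\phi''(t)=0$; and (iii) for all $t\in\mathbb{T}=\{t:\phi'(t)<0\}$, $$-\frac{\rho_*}{1+\rho_*}\;\le\;\frac{t\,\phi''(t)}{\phi'(t)}\;\le\;\frac{\rho_*}{1-\rho_*}.$$ In particular, if $X$ is $\mathrm{MTP}_2$, then $\inf_{t\in\mathbb{T}}\frac{t\phi''(t)}{\phi'(t)}>-\frac12$.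
   Context: A random vector $X=(X_1,\dots,X_d)$ has an elliptical distribution, written $X\sim E(\mu,\Sigma)$, if its characteristic function has the form $\boldsymbol t\mapsto \psi(\boldsymbol t^T\Sigma \boldsymbol t)\exp(i\mu^T \boldsymbol t)$ for some $\psi:[0,\infty)\to\mathbb{R}$, where $\mu\in\mathbb{R}^d$ and $\Sigma$ is a $d\times d$ symmetric matrix. Standing assumptions: $\Sigma$ is positive definite and, in the stochastic representation $X=\mu+\xi\,\Sigma^{1/2}U$ with $U$ uniform on the unit sphere of $\mathbb{R}^d$, $\xi\ge 0$ and $\xi$ independent of $U$, one has $0<\mathbb{E}\xi^2<\infty$. When $X$ has a Lebesgue density it takes the form $p(x)=|\Sigma|^{-1/2}\varphi_d\big((x-\mu)^T\Sigma^{-1}(x-\mu)\big)$, where $\varphi_d$ is a nonnegative function on $[0,\infty)$ called the density generator. Put $V=\{1,\dots,d\}$, $K=\Sigma^{-1}$; the partial correlations are $\rho_{ij\cdot V\setminus\{i,j\}}=-K_{ij}/\sqrt{K_{ii}K_{jj}}$ for $i\ne j$. A random vector with density $p$ on $\mathbb{R}^d$ is multivariate totally positive of order two ($\mathrm{MTP}_2$) if $p(w)p(w')\le p(\min(w,w'))\,p(\max(w,w'))$ for all $w,w'\in\mathbb{R}^d$, where $\min$ and $\max$ are taken coordinatewise. *)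

theory Defs
  imports "HOL-Probability.Probability"
begin

definition pos_def_matrix :: "real^'n^'n \<Rightarrow> bool" where
  "pos_def_matrix A \<longleftrightarrow> transpose A = A \<and> (\<forall>x. x \<noteq> 0 \<longrightarrow> x \<bullet> (A *v x) > 0)"

definition elliptical ::
    "'a measure \<Rightarrow> ('a \<Rightarrow> real^'n) \<Rightarrow> real^'n \<Rightarrow> real^'n^'n \<Rightarrow> bool" where
  "elliptical M X \<mu> \<Sigma> \<longleftrightarrow>
     X \<in> borel_measurable M \<and> transpose \<Sigma> = \<Sigma> \<and>
     (\<exists>\<psi> :: real \<Rightarrow> real. \<forall>t.
        (CLINT \<omega>|M. iexp (t \<bullet> X \<omega>)) =
          complex_of_real (\<psi> (t \<bullet> (\<Sigma> *v t))) * iexp (\<mu> \<bullet> t))"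

(* The radial projection of the uniform distribution on the unit ball; the origin,
   which sgn maps to 0, is a null set. *)
definition uniform_sphere :: "(real^'n) measure" where
  "uniform_sphere = distr (uniform_measure lborel (ball 0 1)) borel sgn"

(* X is equal in distribution to \<mu> + \<xi> R U, where R is the symmetric positive
   definite square root of \<Sigma>. The variables \<xi> and U may live on a probability
   space N other than the space M carrying X. Their
   independence is stated through the generated sigma-algebras because indep_var
   requires both variables to have the same type. *)
definition stochastic_representation ::
    "'a measure \<Rightarrow> ('a \<Rightarrow> real^'n) \<Rightarrow> real^'n \<Rightarrow> real^'n^'n \<Rightarrow>
     'b measure \<Rightarrow> ('b \<Rightarrow> real) \<Rightarrow> ('b \<Rightarrow> real^'n) \<Rightarrow> bool" where
  "stochastic_representation M X \<mu> \<Sigma> N \<xi> U \<longleftrightarrow>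
     prob_space N \<and>
     \<xi> \<in> borel_measurable N \<and> U \<in> borel_measurable N \<and>
     (AE \<omega> in N. 0 \<le> \<xi> \<omega>) \<and>
     distr N borel U = uniform_sphere \<and>
     prob_space.indep_set N
       (sets (vimage_algebra (space N) \<xi> borel)) (sets (vimage_algebra (space N) U borel)) \<and>
     (\<exists>R. pos_def_matrix R \<and> R ** R = \<Sigma> \<and>
          distr M borel X = distr N borel (\<lambda>\<omega>. \<mu> + \<xi> \<omega> *\<^sub>R (R *v U \<omega>)))"

definition elliptical_density ::
    "real^'n \<Rightarrow> real^'n^'n \<Rightarrow> (real \<Rightarrow> real) \<Rightarrow> real^'n \<Rightarrow> real" where
  "elliptical_density \<mu> \<Sigma> \<phi>\<^sub>d x =
     1 / sqrt (det \<Sigma>) * \<phi>\<^sub>d ((x - \<mu>) \<bullet> (matrix_inv \<Sigma> *v (x - \<mu>)))"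

definition partial_corr :: "real^'n^'n \<Rightarrow> 'n \<Rightarrow> 'n \<Rightarrow> real" where
  "partial_corr \<Sigma> i j =
     (let K = matrix_inv \<Sigma> in - (K $ i $ j) / sqrt (K $ i $ i * K $ j $ j))"

definition min_partial_corr :: "real^'n^'n \<Rightarrow> real" where
  "min_partial_corr \<Sigma> = Min {partial_corr \<Sigma> i j | i j. i \<noteq> j}"

(* The inequality is required everywhere, so it refers to the given version p of the
   density of X. *)
definition MTP2 :: "'a measure \<Rightarrow> ('a \<Rightarrow> real^'n) \<Rightarrow> (real^'n \<Rightarrow> real) \<Rightarrow> bool" where
  "MTP2 M X p \<longleftrightarrow>
     distributed M lborel X (\<lambda>x. ennreal (p x)) \<and>
     (\<forall>w w'. p w * p w' \<le>
        p (\<chi> i. min (w $ i) (w' $ i)) * p (\<chi> i. max (w $ i) (w' $ i)))"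

definition twice_differentiable ::
    "('a::real_normed_vector \<Rightarrow> 'b::real_normed_vector) \<Rightarrow> bool" where
  "twice_differentiable f \<longleftrightarrow>
     (\<exists>f'. (\<forall>x. (f has_derivative blinfun_apply (f' x)) (at x)) \<and>
           (\<forall>x. f' differentiable (at x)))"

(* Derivative of a function on [0, \<infinity>): one-sided at 0, two-sided at t > 0.
   It is unspecified where f is not differentiable. For a twice differentiable
   elliptical density, the second derivative of ln \<phi>\<^sub>d may fail to exist at 0,
   but there it enters the theorem only through t * \<phi>'' t / \<phi>' t, which is 0 at t = 0. *)
definition halfline_deriv :: "(real \<Rightarrow> real) \<Rightarrow> real \<Rightarrow> real" where
  "halfline_deriv f t = vector_derivative f (at t within {0..})"

end

theory Submission
  imports Defs
begin

text \<open>
  Write \<open>g = ln \<phi>\<^sub>d\<close>, \<open>K = \<Sigma>\<^sup>-\<^sup>1\<close> and \<open>Q y = y \<bullet> K y\<close>. Taking logarithms and translating by \<open>\<mu>\<close>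
  turns MTP2 into supermodularity of the radial function \<open>g \<circ> Q\<close>
  (\<open>MTP2_elliptical_iff_supermodular\<close>). For a twice differentiable function this is the sign
  condition that all mixed second derivatives are nonnegative, which here reads
  \<open>g'(Q y) K\<^sub>i\<^sub>j + 2 g''(Q y) (K y)\<^sub>i (K y)\<^sub>j \<ge> 0\<close> for \<open>i \<noteq> j\<close>
  (\<open>supermodular_radial_mixed_nonneg\<close> and \<open>supermodular_radialI\<close>).

  On an ellipsoid \<open>Q y = t\<close> the only quantity in this condition that varies is the product
  \<open>(K y)\<^sub>i (K y)\<^sub>j\<close>, a product of two linear functionals that are inner products in the
  geometry of \<open>K\<close>. With \<open>m = sqrt (K\<^sub>i\<^sub>i K\<^sub>j\<^sub>j)\<close> and \<open>r\<close> the partial correlation, so that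
  \<open>K\<^sub>i\<^sub>j = - r m\<close>, Cauchy--Schwarz shows that its minimum and maximum are \<open>- (1 + r) m t / 2\<close> and
  \<open>(1 - r) m t / 2\<close>, and both are attained. The condition is affine in the product, so it holds
  on the whole ellipsoid iff it holds at these two values
  (\<open>mixed_nonneg_on_ellipsoid_iff\<close>):
  \<open>r g' \<le> (1 - r) t g''\<close> and \<open>r g' \<le> - (1 + r) t g''\<close>. Where \<open>g' < 0\<close>, dividing by \<open>g'\<close> gives the
  two bounds on \<open>t g'' / g'\<close>; they are tightest at the smallest \<open>r\<close>. Where \<open>g' = 0\<close> they give
  \<open>g'' = 0\<close>. Where \<open>g' > 0\<close> they contradict each other if \<open>r > 0\<close>.
  The bound \<open>- 1 / 2\<close> on the infimum is strict because partial correlations are below \<open>1\<close>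
  (\<open>pos_def_matrix_offdiag_less\<close>).

  The case of minimal partial correlation \<open>0\<close> needs that \<open>p\<close> is a probability density: then
  \<open>g'' = 0\<close> on the open half-line, so \<open>g'\<close> is constant there, and if it were positive then \<open>p\<close>
  would be bounded below by a positive number, which contradicts integrability.

  Two points concern the origin. From \<open>p\<close> the generator inherits two derivatives at \<open>t > 0\<close>, but
  only a first, one-sided derivative at \<open>t = 0\<close>: the two derivatives of the even function
  \<open>s \<mapsto> g (s\<^sup>2)\<close> at \<open>0\<close> are used up by it (\<open>halfline_deriv_regular\<close>). Accordingly
  \<open>supermodular_radialI\<close> does not differentiate the gradient at \<open>y = 0\<close>; on a segment
  through \<open>0\<close> the signs of its end values suffice.
\<close>

section \<open>Symmetric positive definite forms\<close>

definition bilin :: "real^'n^'n \<Rightarrow> real^'n \<Rightarrow> real^'n \<Rightarrow> real" where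
  "bilin K x y = x \<bullet> (K *v y)"

abbreviation quad :: "real^'n^'n \<Rightarrow> real^'n \<Rightarrow> real" where
  "quad K x \<equiv> bilin K x x"

lemma bilin_simps [simp]:
  "bilin K (x + y) z = bilin K x z + bilin K y z"
  "bilin K z (x + y) = bilin K z x + bilin K z y"
  "bilin K (x - y) z = bilin K x z - bilin K y z"
  "bilin K z (x - y) = bilin K z x - bilin K z y"
  "bilin K (c *\<^sub>R x) y = c * bilin K x y"
  "bilin K x (c *\<^sub>R y) = c * bilin K x y"
  "bilin K (- x) y = - bilin K x y" "bilin K x (- y) = - bilin K x y"
  "bilin K 0 x = 0" "bilin K x 0 = 0"
  by (simp_all add: bilin_def inner_add_left inner_add_right inner_diff_left inner_diff_right
      matrix_vector_right_distrib matrix_vector_mult_diff_distrib matrix_vector_mult_scaleR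
      linear_neg[OF matrix_vector_mul_linear])

lemma bilin_axis [simp]:
  "bilin K (axis i 1) (axis j 1) = K $ i $ j"
  by (simp add: bilin_def inner_axis' matrix_vector_mult_basis column_def)

lemma bilin_eq_sum: "bilin K a b = (\<Sum>i\<in>UNIV. \<Sum>j\<in>UNIV. a $ i * b $ j * K $ i $ j)"
  by (simp add: bilin_def inner_vec_def matrix_vector_mult_def sum_distrib_left mult_ac)

lemma bilin_eq_axis_sum:
  "bilin K a y = (\<Sum>i\<in>UNIV. a $ i * bilin K (axis i 1) y)"
  unfolding bilin_def inner_axis' by (simp add: inner_vec_def)

lemma bilin_commute:
  assumes "transpose K = K"
  shows "bilin K x y = bilin K y x"
  using assms unfolding bilin_def
  by (metis dot_lmul_matrix inner_commute transpose_matrix_vector)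

lemma pos_def_matrixD:
  assumes "pos_def_matrix K"
  shows "transpose K = K" and "x \<noteq> 0 \<Longrightarrow> 0 < quad K x" and "0 \<le> quad K x"
proof -
  show "transpose K = K" and *: "x \<noteq> 0 \<Longrightarrow> 0 < quad K x"
    using assms by (auto simp: pos_def_matrix_def bilin_def)
  show "0 \<le> quad K x"
    using * by (cases "x = 0") (auto simp: less_imp_le)
qed

lemma pos_def_matrix_invertible:
  assumes "pos_def_matrix S"
  shows "invertible S"
proof -
  have "\<forall>x. S *v x = 0 \<longrightarrow> x = 0"
    using assms unfolding pos_def_matrix_def by force
  then obtain B where "B ** S = mat 1"
    using matrix_left_invertible_ker by blast
  then show ?thesis
    unfolding invertible_def using matrix_left_right_inverse by blast
qed

lemma pos_def_matrix_inverse: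
  assumes "pos_def_matrix S"
  shows "pos_def_matrix (matrix_inv S)"
proof -
  define K where "K = matrix_inv S"
  have "S ** K = mat 1 \<and> K ** S = mat 1"
    unfolding K_def matrix_inv_def
    using pos_def_matrix_invertible[OF assms] unfolding invertible_def by (rule someI_ex)
  then have SK: "S ** K = mat 1" and KS: "K ** S = mat 1" by auto
  have tS: "transpose S = S" using assms by (simp add: pos_def_matrix_def)
  have "transpose K ** S = mat 1"
    by (metis SK matrix_transpose_mul tS transpose_mat)
  then have "transpose K = K"
    by (metis SK matrix_mul_assoc matrix_mul_lid matrix_mul_rid)
  moreover have "x \<bullet> (K *v x) > 0" if "x \<noteq> 0" for x
  proof -
    have x: "S *v (K *v x) = x"
      by (simp add: SK matrix_vector_mul_assoc)
    with that have "K *v x \<noteq> 0"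
      by (metis matrix_vector_mult_0_right)
    with assms have "(K *v x) \<bullet> (S *v (K *v x)) > 0"
      unfolding pos_def_matrix_def by blast
    with x show ?thesis by (simp add: inner_commute)
  qed
  ultimately show ?thesis
    unfolding K_def pos_def_matrix_def by blast
qed

lemma bilin_Cauchy_Schwarz:
  assumes K: "pos_def_matrix K"
  shows "(bilin K x y)\<^sup>2 \<le> quad K x * quad K y"
proof (cases "y = 0")
  case False
  define c where "c = bilin K x y / quad K y"
  have pos: "0 < quad K y" using pos_def_matrixD(2)[OF K False] .
  have "0 \<le> quad K (x - c *\<^sub>R y)" by (rule pos_def_matrixD(3)[OF K])
  also have "\<dots> = quad K x - 2 * c * bilin K x y + c\<^sup>2 * quad K y"
    by (simp add: bilin_commute[OF pos_def_matrixD(1)[OF K], of y x] algebra_simps power2_eq_square)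
  also have "\<dots> = quad K x - (bilin K x y)\<^sup>2 / quad K y"
    using pos by (simp add: c_def field_simps power2_eq_square)
  finally show ?thesis using pos by (simp add: field_simps)
qed simp

text \<open>
  With \<open>p = sqrt (quad K u)\<close> and \<open>q = sqrt (quad K v)\<close>, the vectors \<open>q u\<close> and \<open>p v\<close> have the same
  length. Completing the square bounds \<open>4 p q (u|y) (v|y)\<close> above by \<open>(q u + p v|y)\<^sup>2\<close> and below by
  \<open>- (q u - p v|y)\<^sup>2\<close>, and Cauchy--Schwarz bounds both squares by multiples of
  \<open>quad K y\<close>.
\<close>
lemma bilin_product_bounds:
  assumes K: "pos_def_matrix K" and "u \<noteq> 0" "v \<noteq> 0"
  defines "m \<equiv> sqrt (quad K u) * sqrt (quad K v)"
  shows "2 * (bilin K u y * bilin K v y) \<le> (bilin K u v + m) * quad K y"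
    and "(bilin K u v - m) * quad K y \<le> 2 * (bilin K u y * bilin K v y)"
proof -
  define p where "p = sqrt (quad K u)"
  define q where "q = sqrt (quad K v)"
  have pos: "p > 0" "q > 0" and p2: "quad K u = p\<^sup>2" and q2: "quad K v = q\<^sup>2"
    using pos_def_matrixD(2)[OF K] assms(2,3) by (simp_all add: p_def q_def less_imp_le)
  have comm: "bilin K v u = bilin K u v" by (rule bilin_commute[OF pos_def_matrixD(1)[OF K]])
  have m: "m = p * q" by (simp add: m_def p_def q_def)
  have "(q * bilin K u y + p * bilin K v y)\<^sup>2 \<le> 2 * (p * q) * (p * q + bilin K u v) * quad K y"
    using bilin_Cauchy_Schwarz[OF K, of "q *\<^sub>R u + p *\<^sub>R v" y]
    by (simp add: p2 q2 comm algebra_simps power2_eq_square)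
  moreover have "(q * bilin K u y - p * bilin K v y)\<^sup>2
      \<le> 2 * (p * q) * (p * q - bilin K u v) * quad K y"
    using bilin_Cauchy_Schwarz[OF K, of "q *\<^sub>R u - p *\<^sub>R v" y]
    by (simp add: p2 q2 comm algebra_simps power2_eq_square)
  moreover have "4 * (p * q) * (bilin K u y * bilin K v y) \<le> (q * bilin K u y + p * bilin K v y)\<^sup>2"
    using zero_le_power2[of "q * bilin K u y - p * bilin K v y"]
    by (simp add: algebra_simps power2_eq_square)
  moreover have "- (q * bilin K u y - p * bilin K v y)\<^sup>2 \<le> 4 * (p * q) * (bilin K u y * bilin K v y)"
    using zero_le_power2[of "q * bilin K u y + p * bilin K v y"]
    by (simp add: algebra_simps power2_eq_square)
  ultimately have
    "(2 * (p * q)) * (2 * (bilin K u y * bilin K v y)) \<le> (2 * (p * q)) * ((bilin K u v + m) * quad K y)"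
    "(2 * (p * q)) * ((bilin K u v - m) * quad K y) \<le> (2 * (p * q)) * (2 * (bilin K u y * bilin K v y))"
    by (simp_all add: m algebra_simps)
  then show "2 * (bilin K u y * bilin K v y) \<le> (bilin K u v + m) * quad K y"
    and "(bilin K u v - m) * quad K y \<le> 2 * (bilin K u y * bilin K v y)"
    using pos by (simp_all only: mult_le_cancel_left_pos zero_less_mult_iff zero_less_numeral simp_thms)
qed

text \<open>
  Equality in the two bounds above forces \<open>y\<close> to be a multiple of \<open>q u + p v\<close> or of \<open>q u - p v\<close>
  respectively; the sign is \<open>e\<close>. Linear independence keeps these vectors away from \<open>0\<close>, so that
  they can be rescaled to any ellipsoid.
\<close>
lemma bilin_product_attained:
  assumes K: "pos_def_matrix K" and "v \<noteq> 0" and indep: "\<And>c. u \<noteq> c *\<^sub>R v"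
    and e: "e = 1 \<or> e = -1" and "0 < t"
  defines "m \<equiv> sqrt (quad K u) * sqrt (quad K v)"
  shows "\<exists>y. quad K y = t \<and> 2 * (bilin K u y * bilin K v y) = (bilin K u v + e * m) * t"
proof -
  define p where "p = sqrt (quad K u)"
  define q where "q = sqrt (quad K v)"
  have pos: "p > 0" "q > 0" and p2: "quad K u = p\<^sup>2" and q2: "quad K v = q\<^sup>2"
    using pos_def_matrixD(2)[OF K] \<open>v \<noteq> 0\<close> indep[of 0] by (simp_all add: p_def q_def less_imp_le)
  have comm: "bilin K v u = bilin K u v" by (rule bilin_commute[OF pos_def_matrixD(1)[OF K]])
  have m: "m = p * q" by (simp add: m_def p_def q_def)
  have ee: "e * e = 1" using e by auto
  define B where "B = bilin K u v"
  define z where "z = q *\<^sub>R u + (e * p) *\<^sub>R v"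
  have "u = (1 / q) *\<^sub>R z + (- (e * p) / q) *\<^sub>R v"
    using pos by (simp add: z_def scaleR_add_right)
  with indep[of "- (e * p) / q"] have "z \<noteq> 0" by auto
  then have Qz: "quad K z > 0" by (rule pos_def_matrixD(2)[OF K])
  have "quad K z = q * q * p * p + (e * e) * (p * p * q * q) + 2 * e * p * q * B"
    by (simp add: z_def p2 q2 comm B_def[symmetric] algebra_simps power2_eq_square)
  then have qz: "quad K z = 2 * p * q * (p * q + e * B)"
    by (simp add: ee algebra_simps)
  have uz: "bilin K u z = p * (p * q + e * B)"
    by (simp add: z_def p2 q2 B_def algebra_simps power2_eq_square)
  have "bilin K v z = q * B + e * p * q * q"
    by (simp add: z_def p2 q2 comm B_def[symmetric] algebra_simps power2_eq_square)
  then have vz: "bilin K v z = e * q * (p * q + e * B)"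
    using e by (auto simp: algebra_simps)
  define s where "s = sqrt (t / quad K z)"
  have s2: "s * s * quad K z = t"
    using Qz \<open>t > 0\<close> by (simp add: s_def)
  have "2 * (bilin K u (s *\<^sub>R z) * bilin K v (s *\<^sub>R z))
      = s * s * (e * (2 * p * q * (p * q + e * B)) * (p * q + e * B))"
    by (simp add: uz vz mult_ac)
  also have "\<dots> = (s * s * quad K z) * (e * (p * q + e * B))"
    by (simp add: qz mult_ac)
  also have "\<dots> = t * (B + e * m)"
    unfolding s2 using e by (auto simp: m algebra_simps)
  finally show ?thesis
    using s2 by (intro exI[of _ "s *\<^sub>R z"]) (simp add: B_def mult_ac)
qed

section \<open>Supermodularity of radial functions\<close>

definition supermodular :: "(real^'n \<Rightarrow> real) \<Rightarrow> bool" where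
  "supermodular f \<longleftrightarrow> (\<forall>w w'. f w + f w' \<le>
     f (\<chi> i. min (w $ i) (w' $ i)) + f (\<chi> i. max (w $ i) (w' $ i)))"

text \<open>
  Going from the minimum to \<open>w\<close> and to \<open>w'\<close> moves disjoint sets of coordinates upwards. In this
  form supermodularity is a statement about mixed differences, which calculus can reach.
\<close>
lemma supermodular_iff_increments:
  fixes f :: "real^'n \<Rightarrow> real"
  shows "supermodular f \<longleftrightarrow> (\<forall>u a b. (\<forall>i. 0 \<le> a $ i) \<longrightarrow> (\<forall>i. 0 \<le> b $ i) \<longrightarrow>
     (\<forall>i. a $ i * b $ i = 0) \<longrightarrow> f (u + a) + f (u + b) \<le> f u + f (u + a + b))"
proof
  assume f: "supermodular f"
  show "\<forall>u a b. (\<forall>i. 0 \<le> a $ i) \<longrightarrow> (\<forall>i. 0 \<le> b $ i) \<longrightarrow>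
     (\<forall>i. a $ i * b $ i = 0) \<longrightarrow> f (u + a) + f (u + b) \<le> f u + f (u + a + b)"
  proof (intro allI impI)
    fix u a b :: "real^'n"
    assume ab: "\<forall>i. 0 \<le> a $ i" "\<forall>i. 0 \<le> b $ i" "\<forall>i. a $ i * b $ i = 0"
    have "(\<chi> i. min ((u + a) $ i) ((u + b) $ i)) = u"
      and "(\<chi> i. max ((u + a) $ i) ((u + b) $ i)) = u + a + b"
      using ab by (auto simp: vec_eq_iff min_def max_def intro: order_antisym)
        (metis add_cancel_right_right order_antisym)+
    then show "f (u + a) + f (u + b) \<le> f u + f (u + a + b)"
      using f unfolding supermodular_def by metis
  qed
next
  assume *: "\<forall>u a b. (\<forall>i. 0 \<le> a $ i) \<longrightarrow> (\<forall>i. 0 \<le> b $ i) \<longrightarrow>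
     (\<forall>i. a $ i * b $ i = 0) \<longrightarrow> f (u + a) + f (u + b) \<le> f u + f (u + a + b)"
  show "supermodular f"
    unfolding supermodular_def
  proof (intro allI)
    fix w w' :: "real^'n"
    define u where "u = (\<chi> i. min (w $ i) (w' $ i))"
    have "\<forall>i. 0 \<le> (w - u) $ i" "\<forall>i. 0 \<le> (w' - u) $ i" "\<forall>i. (w - u) $ i * (w' - u) $ i = 0"
      by (auto simp: u_def min_def)
    with * have "f (u + (w - u)) + f (u + (w' - u)) \<le> f u + f (u + (w - u) + (w' - u))"
      by blast
    moreover have "u + (w - u) + (w' - u) = (\<chi> i. max (w $ i) (w' $ i))"
      by (auto simp: u_def vec_eq_iff min_def max_def)
    ultimately show "f w + f w' \<le> f (\<chi> i. min (w $ i) (w' $ i)) + f (\<chi> i. max (w $ i) (w' $ i))"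
      by (simp add: u_def)
  qed
qed

lemma supermodular_translate:
  fixes f :: "real^'n \<Rightarrow> real"
  shows "supermodular (\<lambda>x. f (x - c)) \<longleftrightarrow> supermodular f"
proof -
  have "supermodular (\<lambda>x. h (x - d))" if "supermodular h" for h :: "real^'n \<Rightarrow> real" and d
    unfolding supermodular_iff_increments
  proof (intro allI impI)
    fix u a b :: "real^'n"
    assume "\<forall>i. 0 \<le> a $ i" "\<forall>i. 0 \<le> b $ i" "\<forall>i. a $ i * b $ i = 0"
    then have "h ((u - d) + a) + h ((u - d) + b) \<le> h (u - d) + h ((u - d) + a + b)"
      using that unfolding supermodular_iff_increments by blast
    then show "h (u + a - d) + h (u + b - d) \<le> h (u - d) + h (u + a + b - d)"
      by (simp add: algebra_simps)
  qed
  from this[of f c] this[of "\<lambda>x. f (x - c)" "- c"] show ?thesis by auto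
qed

lemma quad_line_deriv:
  assumes "transpose K = K"
  shows "((\<lambda>s. quad K (y + s *\<^sub>R a)) has_real_derivative 2 * bilin K a (y + s *\<^sub>R a)) (at s)"
proof -
  have eq: "(\<lambda>s. quad K (y + s *\<^sub>R a)) = (\<lambda>s. quad K y + 2 * s * bilin K a y + s\<^sup>2 * quad K a)"
    by (auto simp: bilin_commute[OF assms, of y a] algebra_simps power2_eq_square)
  show ?thesis
    unfolding eq by (auto intro!: derivative_eq_intros simp: algebra_simps)
qed

text \<open>
  The form takes values in the half-line, so a one-sided derivative of \<open>g\<close> at \<open>0\<close> is enough for
  the chain rule, even at \<open>y = 0\<close>.
\<close>
lemma radial_line_deriv:
  assumes K: "pos_def_matrix K"
    and g: "\<And>t. 0 \<le> t \<Longrightarrow> (g has_real_derivative g1 t) (at t within {0..})"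
  shows "((\<lambda>s. g (quad K (y + s *\<^sub>R a))) has_real_derivative
     g1 (quad K (y + s *\<^sub>R a)) * (2 * bilin K a (y + s *\<^sub>R a))) (at s)"
proof -
  have "(g has_real_derivative g1 (quad K (y + s *\<^sub>R a)))
      (at (quad K (y + s *\<^sub>R a)) within range (\<lambda>s. quad K (y + s *\<^sub>R a)))"
    by (rule DERIV_subset[OF g]) (auto simp del: bilin_simps intro: pos_def_matrixD(3)[OF K])
  from DERIV_image_chain[OF this quad_line_deriv[OF pos_def_matrixD(1)[OF K]]]
  show ?thesis by (simp add: o_def del: bilin_simps)
qed

lemma gradient_line_deriv:
  assumes K: "pos_def_matrix K"
    and g1: "\<And>t. 0 < t \<Longrightarrow> (g1 has_real_derivative g2 t) (at t)"
    and nz: "y + r *\<^sub>R b \<noteq> 0"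
  shows "((\<lambda>r. g1 (quad K (y + r *\<^sub>R b)) * bilin K a (y + r *\<^sub>R b)) has_real_derivative
     g1 (quad K (y + r *\<^sub>R b)) * bilin K a b
     + 2 * g2 (quad K (y + r *\<^sub>R b)) * (bilin K a (y + r *\<^sub>R b) * bilin K b (y + r *\<^sub>R b))) (at r)"
proof -
  have 1: "((\<lambda>r. g1 (quad K (y + r *\<^sub>R b))) has_real_derivative
      g2 (quad K (y + r *\<^sub>R b)) * (2 * bilin K b (y + r *\<^sub>R b))) (at r)"
    by (rule DERIV_chain2[OF g1[OF pos_def_matrixD(2)[OF K nz]]
          quad_line_deriv[OF pos_def_matrixD(1)[OF K]]])
  have 2: "((\<lambda>r. bilin K a (y + r *\<^sub>R b)) has_real_derivative bilin K a b) (at r)"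
    by (auto intro!: derivative_eq_intros)
  show ?thesis
    by (rule DERIV_cong[OF DERIV_mult[OF 1 2]]) (simp add: mult_ac del: bilin_simps)
qed

lemma deriv_nonneg_of_right_min:
  assumes "(f has_real_derivative D) (at x)" and "\<And>h. h > 0 \<Longrightarrow> f x \<le> f (x + h)"
  shows "0 \<le> (D::real)"
proof (rule ccontr)
  assume "\<not> 0 \<le> D"
  with DERIV_neg_dec_right[OF assms(1)]
  obtain d where "d > 0" "\<forall>h > 0. h < d \<longrightarrow> f x > f (x + h)" by auto
  then have "f x > f (x + d / 2)" by simp
  with assms(2)[of "d / 2"] \<open>d > 0\<close> show False by simp
qed

text \<open>
  Supermodularity makes the increment of \<open>g \<circ> Q\<close> over a step in direction \<open>j\<close> increase along
  direction \<open>i\<close>. Differentiating in direction \<open>i\<close> shows that the partial derivative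
  \<open>2 g'(Q y) (K y)\<^sub>i\<close> increases along direction \<open>j\<close>, and a second differentiation gives
  the claim.
\<close>
lemma supermodular_radial_mixed_nonneg:
  fixes K :: "real^'n^'n"
  assumes K: "pos_def_matrix K"
    and g: "\<And>t. 0 \<le> t \<Longrightarrow> (g has_real_derivative g1 t) (at t within {0..})"
    and g1: "\<And>t. 0 < t \<Longrightarrow> (g1 has_real_derivative g2 t) (at t)"
    and sm: "supermodular (\<lambda>y. g (quad K y))"
    and "i \<noteq> j" "y \<noteq> 0"
  shows "0 \<le> g1 (quad K y) * K $ i $ j
     + 2 * g2 (quad K y) * (bilin K (axis i 1) y * bilin K (axis j 1) y)"
proof -
  let ?a = "axis i 1 :: real^'n" and ?b = "axis j 1 :: real^'n"
  let ?G = "\<lambda>y. g1 (quad K y) * bilin K ?a y"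
  have G: "?G y \<le> ?G (y + r *\<^sub>R ?b)" if "r > 0" for r
  proof -
    let ?h = "\<lambda>s. g (quad K ((y + r *\<^sub>R ?b) + s *\<^sub>R ?a)) - g (quad K (y + s *\<^sub>R ?a))"
    have "(?h has_real_derivative 2 * (?G (y + r *\<^sub>R ?b) - ?G y)) (at 0)"
      by (rule DERIV_cong[OF DERIV_diff[OF radial_line_deriv[OF K g] radial_line_deriv[OF K g]]])
        (simp_all add: algebra_simps del: bilin_simps)
    moreover have "?h 0 \<le> ?h (0 + s)" if "s > 0" for s
    proof -
      have "\<forall>k. 0 \<le> (s *\<^sub>R ?a) $ k" "\<forall>k. 0 \<le> (r *\<^sub>R ?b) $ k"
        "\<forall>k. (s *\<^sub>R ?a) $ k * (r *\<^sub>R ?b) $ k = 0"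
        using \<open>r > 0\<close> \<open>s > 0\<close> \<open>i \<noteq> j\<close> by (auto simp: axis_def)
      then have "g (quad K (y + s *\<^sub>R ?a)) + g (quad K (y + r *\<^sub>R ?b))
          \<le> g (quad K y) + g (quad K (y + s *\<^sub>R ?a + r *\<^sub>R ?b))"
        using sm unfolding supermodular_iff_increments by blast
      moreover have "y + s *\<^sub>R ?a + r *\<^sub>R ?b = y + r *\<^sub>R ?b + s *\<^sub>R ?a" by simp
      ultimately show ?thesis by (simp del: bilin_simps)
    qed
    ultimately have "0 \<le> 2 * (?G (y + r *\<^sub>R ?b) - ?G y)"
      by (rule deriv_nonneg_of_right_min)
    then show ?thesis by simp
  qed
  have "((\<lambda>r. ?G (y + r *\<^sub>R ?b)) has_real_derivative g1 (quad K y) * K $ i $ j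
     + 2 * g2 (quad K y) * (bilin K ?a y * bilin K ?b y)) (at 0)"
    by (rule DERIV_cong[OF gradient_line_deriv[OF K g1]]) (use \<open>y \<noteq> 0\<close> in simp_all)
  moreover have "?G (y + 0 *\<^sub>R ?b) \<le> ?G (y + (0 + r) *\<^sub>R ?b)" if "r > 0" for r
    using G[OF that] by (simp only: scaleR_zero_left add_0_left add_0_right)
  ultimately show ?thesis
    by (rule deriv_nonneg_of_right_min)
qed

text \<open>
  The converse differentiates the mixed difference over the rectangle spanned by \<open>a\<close> and \<open>b\<close>
  first along \<open>a\<close> and then along \<open>b\<close>, applying the mean value theorem each time. Expanding
  bilinearly in \<open>a\<close> and \<open>b\<close>, whose supports are disjoint, leaves only the mixed derivatives in two
  different coordinates.
\<close>
lemma supermodular_radialI: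
  fixes K :: "real^'n^'n"
  assumes K: "pos_def_matrix K"
    and g: "\<And>t. 0 \<le> t \<Longrightarrow> (g has_real_derivative g1 t) (at t within {0..})"
    and g1: "\<And>t. 0 < t \<Longrightarrow> (g1 has_real_derivative g2 t) (at t)"
    and K_off: "\<And>i j. i \<noteq> j \<Longrightarrow> K $ i $ j \<le> 0"
    and g1_le: "\<And>t. 0 \<le> t \<Longrightarrow> g1 t \<le> 0"
    and mixed: "\<And>i j y. i \<noteq> j \<Longrightarrow> y \<noteq> 0 \<Longrightarrow> 0 \<le> g1 (quad K y) * K $ i $ j
       + 2 * g2 (quad K y) * (bilin K (axis i 1) y * bilin K (axis j 1) y)"
  shows "supermodular (\<lambda>y. g (quad K y))"
  unfolding supermodular_iff_increments
proof (intro allI impI)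
  fix u a b :: "real^'n"
  assume a: "\<forall>i. 0 \<le> a $ i" and b: "\<forall>i. 0 \<le> b $ i" and ab: "\<forall>i. a $ i * b $ i = 0"
  let ?G = "\<lambda>y. g1 (quad K y) * bilin K a y"
  (* The directional derivative of g o Q along a, up to the factor 2, increases along b. *)
  have G: "?G z \<le> ?G (z + b)" for z
  proof (cases "\<exists>r\<in>{0..1}. z + r *\<^sub>R b = 0")
    case True
    (* The segment passes through the origin, where ?G need not be differentiable. Both ends
       are multiples of b of opposite sign, which makes the left value nonpositive and the
       right value nonnegative. *)
    then obtain r where r: "0 \<le> r" "r \<le> 1" and z: "z = - r *\<^sub>R b"
      by (auto simp: add_eq_0_iff2)
    then have zb: "z + b = (1 - r) *\<^sub>R b" by (simp add: algebra_simps)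
    have "a $ i * b $ j * K $ i $ j \<le> 0" for i j
    proof (cases "i = j")
      case False
      then show ?thesis using a b K_off[OF False] by (simp add: mult_nonneg_nonpos)
    qed (use ab[rule_format, of j] in auto)
    then have Kab: "bilin K a b \<le> 0"
      unfolding bilin_eq_sum by (intro sum_nonpos)
    have "g1 (quad K z) \<le> 0" "g1 (quad K (z + b)) \<le> 0"
      by (intro g1_le pos_def_matrixD(3)[OF K])+
    moreover have "bilin K a z = - r * bilin K a b" "bilin K a (z + b) = (1 - r) * bilin K a b"
      unfolding zb by (simp_all add: z)
    ultimately have "?G z \<le> 0" "0 \<le> ?G (z + b)"
      using r Kab by (auto simp: mult_le_0_iff zero_le_mult_iff simp del: bilin_simps)
    then show ?thesis by (rule order_trans)
  next
    case False
    have "?G (z + 0 *\<^sub>R b) \<le> ?G (z + 1 *\<^sub>R b)"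
    proof (rule DERIV_nonneg_imp_nondecreasing[of 0 1 "\<lambda>r. ?G (z + r *\<^sub>R b)"])
      fix r :: real assume "0 \<le> r" "r \<le> 1"
      with False have nz: "z + r *\<^sub>R b \<noteq> 0" by auto
      define y where "y = z + r *\<^sub>R b"
      have "a $ i * b $ j * (g1 (quad K y) * K $ i $ j
          + 2 * g2 (quad K y) * (bilin K (axis i 1) y * bilin K (axis j 1) y)) \<ge> 0" for i j
      proof (cases "i = j")
        case False
        then show ?thesis using a b mixed[OF False nz] by (simp add: y_def)
      qed (use ab[rule_format, of j] in auto)
      then have "0 \<le> (\<Sum>i\<in>UNIV. \<Sum>j\<in>UNIV. a $ i * b $ j * (g1 (quad K y) * K $ i $ j
          + 2 * g2 (quad K y) * (bilin K (axis i 1) y * bilin K (axis j 1) y)))"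
        by (intro sum_nonneg)
      also have "\<dots> = g1 (quad K y) * bilin K a b + 2 * g2 (quad K y) * (bilin K a y * bilin K b y)"
        unfolding bilin_eq_sum[of K a b] bilin_eq_axis_sum[of K a y] bilin_eq_axis_sum[of K b y]
          sum_product
        by (simp add: sum_distrib_left sum.distrib distrib_left mult_ac)
      finally show "\<exists>D. ((\<lambda>r. ?G (z + r *\<^sub>R b)) has_real_derivative D) (at r) \<and> 0 \<le> D"
        using gradient_line_deriv[OF K g1 nz] unfolding y_def by blast
    qed simp
    then show ?thesis by (simp del: bilin_simps)
  qed
  let ?h = "\<lambda>s. g (quad K ((u + b) + s *\<^sub>R a)) - g (quad K (u + s *\<^sub>R a))"
  have "?h 0 \<le> ?h 1"
  proof (rule DERIV_nonneg_imp_nondecreasing[of 0 1 ?h])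
    fix s :: real
    have "(?h has_real_derivative 2 * (?G ((u + s *\<^sub>R a) + b) - ?G (u + s *\<^sub>R a))) (at s)"
      by (rule DERIV_cong[OF DERIV_diff[OF radial_line_deriv[OF K g] radial_line_deriv[OF K g]]])
        (simp_all add: algebra_simps del: bilin_simps)
    then show "\<exists>D. (?h has_real_derivative D) (at s) \<and> 0 \<le> D"
      using G[of "u + s *\<^sub>R a"] by (intro exI) auto
  qed simp
  then show "g (quad K (u + a)) + g (quad K (u + b)) \<le> g (quad K u) + g (quad K (u + a + b))"
    by (simp add: add.commute add.left_commute del: bilin_simps)
qed

section \<open>The range of the mixed derivative on an ellipsoid\<close>

lemma pos_def_matrix_diag_pos:
  assumes "pos_def_matrix K"
  shows "0 < K $ i $ i"
  using pos_def_matrixD(2)[OF assms, of "axis i 1"] by simp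

text \<open>
  This is the strict Cauchy--Schwarz inequality for two basis vectors: all partial correlations
  have absolute value below \<open>1\<close>.
\<close>
lemma pos_def_matrix_offdiag_less:
  fixes K :: "real^'n^'n"
  assumes K: "pos_def_matrix K" and "i \<noteq> j"
  shows "\<bar>K $ i $ j\<bar> < sqrt (K $ i $ i * K $ j $ j)"
proof -
  let ?z = "(K $ j $ j) *\<^sub>R axis i 1 - (K $ i $ j) *\<^sub>R axis j 1 :: real^'n"
  have pos: "0 < K $ j $ j" by (rule pos_def_matrix_diag_pos[OF K])
  have "?z $ i = K $ j $ j" using \<open>i \<noteq> j\<close> by (simp add: axis_def)
  with pos have "?z \<noteq> 0" by (metis less_irrefl zero_index)
  then have "0 < quad K ?z" by (rule pos_def_matrixD(2)[OF K])
  moreover have "K $ j $ i = K $ i $ j"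
    using bilin_commute[OF pos_def_matrixD(1)[OF K], of "axis i 1" "axis j 1"] by simp
  ultimately have "0 < K $ j $ j * (K $ i $ i * K $ j $ j - (K $ i $ j)\<^sup>2)"
    by (simp add: algebra_simps power2_eq_square)
  then have "(K $ i $ j)\<^sup>2 < K $ i $ i * K $ j $ j"
    using pos by (simp add: zero_less_mult_iff)
  then have "sqrt ((K $ i $ j)\<^sup>2) < sqrt (K $ i $ i * K $ j $ j)"
    by (rule real_sqrt_less_mono)
  then show ?thesis by simp
qed

text \<open>
  For fixed \<open>\<alpha>\<close> and \<open>\<beta>\<close>, which stand for \<open>g' t\<close> and \<open>g'' t\<close>, the expression is affine in the product
  of the two coordinates of \<open>K y\<close>. The two inequalities on the right are its
  nonnegativity at the largest and at the smallest value of that product, divided by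
  \<open>m = sqrt (K\<^sub>i\<^sub>i K\<^sub>j\<^sub>j)\<close>.
\<close>
lemma mixed_nonneg_on_ellipsoid_iff:
  fixes K :: "real^'n^'n"
  assumes K: "pos_def_matrix K" and "i \<noteq> j" and "0 < t"
  defines "r \<equiv> - (K $ i $ j) / sqrt (K $ i $ i * K $ j $ j)"
  shows "(\<forall>y. quad K y = t \<longrightarrow>
       0 \<le> \<alpha> * K $ i $ j + 2 * \<beta> * (bilin K (axis i 1) y * bilin K (axis j 1) y)) \<longleftrightarrow>
     r * \<alpha> \<le> (1 - r) * (t * \<beta>) \<and> r * \<alpha> \<le> - ((1 + r) * (t * \<beta>))"
    (is "?L \<longleftrightarrow> ?R")
proof -
  let ?u = "axis i 1 :: real^'n" and ?v = "axis j 1 :: real^'n"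
  define m where "m = sqrt (K $ i $ i) * sqrt (K $ j $ j)"
  have pos: "0 < K $ i $ i" "0 < K $ j $ j" by (rule pos_def_matrix_diag_pos[OF K])+
  then have m: "0 < m" by (simp add: m_def)
  have k: "K $ i $ j = - r * m"
    using pos by (simp add: r_def m_def real_sqrt_mult)
  have nz: "?u \<noteq> 0" "?v \<noteq> 0" by (simp_all add: axis_eq_0_iff)
  have indep: "?u \<noteq> c *\<^sub>R ?v" for c
  proof
    assume "?u = c *\<^sub>R ?v"
    then have "?u $ i = (c *\<^sub>R ?v) $ i" by simp
    with \<open>i \<noteq> j\<close> show False by (simp add: axis_def)
  qed
  have eq: "\<alpha> * K $ i $ j + 2 * \<beta> * (bilin K ?u y * bilin K ?v y)
      = \<beta> * (2 * (bilin K ?u y * bilin K ?v y)) - \<alpha> * (r * m)" for y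
    by (simp add: k)
  show ?thesis
  proof
    assume L: ?L
    have "\<exists>y. quad K y = t \<and> 2 * (bilin K ?u y * bilin K ?v y) = (- r * m + e * m) * t"
      if "e = 1 \<or> e = -1" for e
      using bilin_product_attained[OF K nz(2) indep that \<open>0 < t\<close>] by (simp add: k m_def[symmetric])
    from this[of 1] this[of "-1"] obtain y z
      where y: "quad K y = t" "2 * (bilin K ?u y * bilin K ?v y) = (- r * m + m) * t"
        and z: "quad K z = t" "2 * (bilin K ?u z * bilin K ?v z) = (- r * m - m) * t"
      by auto
    have "0 \<le> \<beta> * ((- r * m + m) * t) - \<alpha> * (r * m)"
      using L y unfolding eq by metis
    then have "m * (r * \<alpha>) \<le> m * ((1 - r) * (t * \<beta>))" by (simp add: algebra_simps)
    moreover have "0 \<le> \<beta> * ((- r * m - m) * t) - \<alpha> * (r * m)"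
      using L z unfolding eq by metis
    then have "m * (r * \<alpha>) \<le> m * (- ((1 + r) * (t * \<beta>)))" by (simp add: algebra_simps)
    ultimately show ?R using m by (simp only: mult_le_cancel_left_pos)
  next
    assume R: ?R
    show ?L
    proof (intro allI impI)
      fix y assume y: "quad K y = t"
      define q where "q = 2 * (bilin K ?u y * bilin K ?v y)"
      have q: "q \<le> m * ((1 - r) * t)" "- (m * ((1 + r) * t)) \<le> q"
        using bilin_product_bounds[OF K nz, of y]
        by (simp_all add: y k m_def[symmetric] q_def algebra_simps)
      have "m * (r * \<alpha>) \<le> \<beta> * q"
      proof (cases "0 \<le> \<beta>")
        case True
        have "m * (r * \<alpha>) \<le> m * (- ((1 + r) * (t * \<beta>)))"
          using R m by (intro mult_left_mono) auto
        also have "\<dots> = \<beta> * (- (m * ((1 + r) * t)))" by simp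
        also have "\<dots> \<le> \<beta> * q" using q True by (intro mult_left_mono)
        finally show ?thesis .
      next
        case False
        have "m * (r * \<alpha>) \<le> m * ((1 - r) * (t * \<beta>))"
          using R m by (intro mult_left_mono) auto
        also have "\<dots> = \<beta> * (m * ((1 - r) * t))" by simp
        also have "\<dots> \<le> \<beta> * q" using q False by (intro mult_left_mono_neg) auto
        finally show ?thesis .
      qed
      then show "0 \<le> \<alpha> * K $ i $ j + 2 * \<beta> * (bilin K ?u y * bilin K ?v y)"
        unfolding eq q_def[symmetric] by (simp add: mult_ac)
    qed
  qed
qed

section \<open>Regularity of the density generator\<close>

lemma halfline_deriv_eqI:
  assumes "(f has_real_derivative D) (at t within {0..})" and "0 \<le> t"
  shows "halfline_deriv f t = D"
proof -
  have "at t within {0..} \<noteq> bot"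
  proof (cases "t = 0")
    case True
    then show ?thesis by (simp add: at_within_Ici_at_right)
  next
    case False
    with \<open>0 \<le> t\<close> have "at t within {0..} = at t" by (intro at_within_interior) simp
    then show ?thesis by simp
  qed
  then show ?thesis
    unfolding halfline_deriv_def using assms(1)
    by (intro vector_derivative_within) (simp_all add: has_real_derivative_iff_has_vector_derivative)
qed

text \<open>
  At \<open>t > 0\<close> substitute \<open>s = sqrt t\<close>. At \<open>0\<close> the even function \<open>s \<mapsto> g (s\<^sup>2)\<close> has derivative \<open>0\<close>, so
  \<open>g' t = k1 (sqrt t) / (2 sqrt t)\<close> tends to \<open>k2 0 / 2\<close>, and l'Hopital's rule makes this limit the
  one-sided derivative of \<open>g\<close>.
\<close>
lemma halfline_deriv_regular:
  assumes k: "\<And>s. ((\<lambda>s. g (s\<^sup>2)) has_real_derivative k1 s) (at s)"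
    and k1: "\<And>s::real. (k1 has_real_derivative k2 s) (at s)"
  shows "0 \<le> t \<Longrightarrow> (g has_real_derivative halfline_deriv g t) (at t within {0..})"
    and "0 < t \<Longrightarrow> (halfline_deriv g has_real_derivative halfline_deriv (halfline_deriv g) t) (at t)"
proof -
  have g_pos: "(g has_real_derivative k1 (sqrt t) * (inverse (sqrt t) / 2)) (at t)" if "0 < t" for t
  proof (rule has_field_derivative_transform_within_open[of _ _ _ "{0<..}"])
    show "((\<lambda>t. g ((sqrt t)\<^sup>2)) has_real_derivative k1 (sqrt t) * (inverse (sqrt t) / 2)) (at t)"
      by (rule DERIV_chain2[OF k DERIV_real_sqrt[OF that]])
  qed (use that in auto)
  have g1_pos: "halfline_deriv g t = k1 (sqrt t) * (inverse (sqrt t) / 2)" if "0 < t" for t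
    by (rule halfline_deriv_eqI[OF DERIV_subset[OF g_pos[OF that]]]) (use that in auto)
  have "((\<lambda>s. g (s\<^sup>2)) has_real_derivative - k1 0) (at 0)"
    using k[of 0] DERIV_mirror[where f = "\<lambda>s. g (s\<^sup>2)" and x = 0 and y = "k1 0"] by simp
  from DERIV_unique[OF k this] have k1_0: "k1 0 = 0" by simp
  have sqrt_lim: "filterlim sqrt (at_right 0) (at_right 0)"
    unfolding filterlim_at
    using tendsto_real_sqrt[OF tendsto_ident_at, of 0 "{0<..}"]
    by (auto simp: eventually_at_filter)
  have "((\<lambda>s. k1 s / s) \<longlongrightarrow> k2 0) (at_right 0)"
    using k1[of 0] by (auto simp: has_field_derivative_iff k1_0 filterlim_at_split)
  from filterlim_compose[OF this sqrt_lim]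
  have lim: "((\<lambda>t. k1 (sqrt t) / sqrt t) \<longlongrightarrow> k2 0) (at_right 0)" .
  have g_0: "(g has_real_derivative k2 0 / 2) (at 0 within {0..})"
    unfolding has_field_derivative_iff at_within_Ici_at_right
  proof (rule lhopital_right_0)
    have "((\<lambda>s. g (s\<^sup>2)) \<longlongrightarrow> g 0) (at_right 0)"
      using DERIV_isCont[OF k[of 0]] by (auto simp: isCont_def filterlim_at_split)
    from filterlim_compose[OF this sqrt_lim]
    have "((\<lambda>t. g ((sqrt t)\<^sup>2)) \<longlongrightarrow> g 0) (at_right 0)" .
    moreover have "\<forall>\<^sub>F t in at_right 0. g ((sqrt t)\<^sup>2) = g t"
      by (auto simp: eventually_at_filter)
    ultimately have "(g \<longlongrightarrow> g 0) (at_right 0)"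
      using tendsto_cong by fast
    then show "((\<lambda>t. g t - g 0) \<longlongrightarrow> 0) (at_right 0)"
      by (simp add: LIM_zero)
    show "((\<lambda>t. t - 0) \<longlongrightarrow> (0::real)) (at_right 0)" by simp
    show "\<forall>\<^sub>F t in at_right 0. t - 0 \<noteq> (0::real)" "\<forall>\<^sub>F t in at_right (0::real). (1::real) \<noteq> 0"
      by (auto simp: eventually_at_filter)
    show "\<forall>\<^sub>F t in at_right 0.
        ((\<lambda>t. g t - g 0) has_real_derivative k1 (sqrt t) * (inverse (sqrt t) / 2)) (at t)"
    proof (rule eventually_mono[OF eventually_at_right_less])
      fix t :: real assume "0 < t"
      from DERIV_diff[OF g_pos[OF this] DERIV_const[of "g 0"]]
      show "((\<lambda>t. g t - g 0) has_real_derivative k1 (sqrt t) * (inverse (sqrt t) / 2)) (at t)"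
        by simp
    qed
    show "\<forall>\<^sub>F t in at_right 0. ((\<lambda>t. t - 0) has_real_derivative 1) (at (t::real))"
      by (auto intro!: derivative_eq_intros)
    show "((\<lambda>t. k1 (sqrt t) * (inverse (sqrt t) / 2) / 1) \<longlongrightarrow> k2 0 / 2) (at_right 0)"
      using tendsto_divide[OF lim tendsto_const[of 2]] by (simp add: field_simps)
  qed
  show "(g has_real_derivative halfline_deriv g t) (at t within {0..})" if "0 \<le> t"
  proof (cases "t = 0")
    case True
    show ?thesis
      using g_0 unfolding True halfline_deriv_eqI[OF g_0 order_refl] .
  next
    case False
    with that have "0 < t" by simp
    then show ?thesis using DERIV_subset[OF g_pos] g1_pos by (metis subset_UNIV)
  qed
  show "(halfline_deriv g has_real_derivative halfline_deriv (halfline_deriv g) t) (at t)" if "0 < t"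
  proof -
    have "((\<lambda>t. k1 (sqrt t) * (inverse (sqrt t) / 2)) has_real_derivative
        k1 (sqrt t) * (- (inverse (sqrt t) * (inverse (sqrt t) / 2) * inverse (sqrt t)) / 2)
        + k2 (sqrt t) * (inverse (sqrt t) / 2) * (inverse (sqrt t) / 2)) (at t)"
      by (rule DERIV_mult'[OF DERIV_chain2[OF k1 DERIV_real_sqrt[OF that]]
            DERIV_cdivide[OF DERIV_inverse'[OF DERIV_real_sqrt[OF that]]]])
        (use that in simp)
    then obtain D where "((\<lambda>t. k1 (sqrt t) * (inverse (sqrt t) / 2)) has_real_derivative D) (at t)"
      by blast
    then have D: "(halfline_deriv g has_real_derivative D) (at t)"
      by (rule has_field_derivative_transform_within_open[of _ _ _ "{0<..}"])
        (use that g1_pos in auto)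
    then show ?thesis
      using halfline_deriv_eqI[OF DERIV_subset[OF D]] that by simp
  qed
qed

lemma twice_differentiable_line:
  assumes "twice_differentiable (p :: real^'n \<Rightarrow> real)"
  obtains h1 h2 where "\<And>s. ((\<lambda>s. p (c + s *\<^sub>R e)) has_real_derivative h1 s) (at s)"
    and "\<And>s. (h1 has_real_derivative h2 s) (at s)"
proof -
  obtain p' where p': "\<And>x. (p has_derivative blinfun_apply (p' x)) (at x)"
    and diff: "\<And>x. p' differentiable (at x)"
    using assms unfolding twice_differentiable_def by blast
  have line: "((\<lambda>s. c + s *\<^sub>R e) has_derivative (\<lambda>h. h *\<^sub>R e)) (at s)" for s :: real
    by (auto intro!: derivative_eq_intros)
  have 1: "((\<lambda>s. p (c + s *\<^sub>R e)) has_real_derivative blinfun_apply (p' (c + s *\<^sub>R e)) e) (at s)" for s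
    unfolding has_field_derivative_def
    by (rule has_derivative_eq_rhs[OF has_derivative_compose[OF line p']])
      (auto simp: blinfun.scaleR_right)
  have 2: "\<exists>D. ((\<lambda>s. blinfun_apply (p' (c + s *\<^sub>R e)) e) has_real_derivative D) (at s)" for s
  proof -
    obtain p'' where "(p' has_derivative p'') (at (c + s *\<^sub>R e))"
      using diff unfolding differentiable_def by blast
    from has_derivative_compose[OF line this]
    have "((\<lambda>s. p' (c + s *\<^sub>R e)) has_derivative (\<lambda>h. p'' (h *\<^sub>R e))) (at s)" .
    note d = bounded_linear.has_derivative[OF blinfun.bounded_linear_left[of e] this]
    have "(\<lambda>s. blinfun_apply (p' (c + s *\<^sub>R e)) e) differentiable (at s)"
      unfolding differentiable_def by (rule exI) (rule d)
    then show ?thesis by (simp add: real_differentiable_def)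
  qed
  have "\<exists>h2. \<forall>s. ((\<lambda>s. blinfun_apply (p' (c + s *\<^sub>R e)) e) has_real_derivative h2 s) (at s)"
    by (intro choice allI 2)
  then obtain h2 where
    "\<forall>s. ((\<lambda>s. blinfun_apply (p' (c + s *\<^sub>R e)) e) has_real_derivative h2 s) (at s)" ..
  then show thesis by (intro that[OF 1]) (rule spec)
qed

text \<open>
  The substitution \<open>t = s\<^sup>2\<close> turns the one-sided derivative at \<open>0\<close> into a two-sided derivative
  with value \<open>0\<close>, so the sign of the derivative on the open half-line decides.
\<close>
lemma halfline_mono:
  assumes g: "\<And>t. 0 \<le> t \<Longrightarrow> (g has_real_derivative g1 t) (at t within {0..})"
    and g1: "\<And>t. 0 < t \<Longrightarrow> 0 \<le> g1 t" and "0 \<le> t"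
  shows "g 0 \<le> (g t :: real)"
proof -
  have "g (0\<^sup>2) \<le> g ((sqrt t)\<^sup>2)"
  proof (rule DERIV_nonneg_imp_nondecreasing[of 0 "sqrt t" "\<lambda>s. g (s\<^sup>2)"])
    fix s :: real assume s: "0 \<le> s"
    have "(g has_real_derivative g1 (s\<^sup>2)) (at (s\<^sup>2) within range (\<lambda>s::real. s\<^sup>2))"
      by (rule DERIV_subset[OF g]) auto
    moreover have "((\<lambda>s. s\<^sup>2) has_real_derivative 2 * s) (at s)"
      by (auto intro!: derivative_eq_intros)
    ultimately have "((\<lambda>s. g (s\<^sup>2)) has_real_derivative g1 (s\<^sup>2) * (2 * s)) (at s)"
      using DERIV_image_chain[of g "g1 (s\<^sup>2)" "\<lambda>s. s\<^sup>2" s UNIV "2 * s"] by (simp add: o_def)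
    moreover have "0 \<le> g1 (s\<^sup>2) * (2 * s)"
      using g1[of "s\<^sup>2"] s by (cases "s = 0") auto
    ultimately show "\<exists>D. ((\<lambda>s. g (s\<^sup>2)) has_real_derivative D) (at s) \<and> 0 \<le> D" by blast
  qed (use \<open>0 \<le> t\<close> in simp)
  then show ?thesis using \<open>0 \<le> t\<close> by simp
qed

lemma density_not_bounded_below:
  fixes X :: "'a \<Rightarrow> real^'n"
  assumes "prob_space M" and X: "distributed M lborel X (\<lambda>x. ennreal (p x))" and "0 < c"
  shows "\<exists>x. p x < c"
proof (rule ccontr)
  assume "\<not> ?thesis"
  then have c: "c \<le> p x" for x by (simp add: not_less)
  interpret prob_space M by fact
  have "emeasure M (X -` UNIV \<inter> space M) = (\<integral>\<^sup>+x. ennreal (p x) * indicator UNIV x \<partial>lborel)"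
    by (rule distributed_emeasure[OF X]) simp
  then have "(\<integral>\<^sup>+x. ennreal (p x) \<partial>lborel) = 1"
    by (simp add: emeasure_space_1)
  moreover have "(\<integral>\<^sup>+x. ennreal c \<partial>(lborel :: (real^'n) measure)) \<le> (\<integral>\<^sup>+x. ennreal (p x) \<partial>lborel)"
    by (intro nn_integral_mono ennreal_leI c)
  ultimately show False
    using \<open>0 < c\<close> by (simp add: ennreal_mult_top top_unique)
qed


text \<open>
  Restricting \<open>p\<close> to a line through \<open>\<mu>\<close>, in a direction of length \<open>1\<close> with respect to \<open>K\<close>, gives
  \<open>s \<mapsto> c \<phi> (s\<^sup>2)\<close> on the whole real line.
\<close>
lemma elliptical_generator_regular:
  fixes K :: "real^'n^'n"
  assumes K: "pos_def_matrix K" and "0 < c"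
    and p: "\<And>x. p x = c * \<phi> (quad K (x - \<mu>))"
    and "twice_differentiable p" and \<phi>: "\<And>t. 0 \<le> t \<Longrightarrow> 0 < \<phi> t"
  defines "g \<equiv> \<lambda>t. ln (\<phi> t)"
  shows "0 \<le> t \<Longrightarrow> (g has_real_derivative halfline_deriv g t) (at t within {0..})"
    and "0 < t \<Longrightarrow> (halfline_deriv g has_real_derivative halfline_deriv (halfline_deriv g) t) (at t)"
proof -
  fix i :: 'n
  define e :: "real^'n" where "e = (1 / sqrt (K $ i $ i)) *\<^sub>R axis i 1"
  have Qe: "quad K (s *\<^sub>R e) = s\<^sup>2" for s
    using pos_def_matrix_diag_pos[OF K, of i] by (simp add: e_def power2_eq_square)
  obtain h1 h2 where h1: "\<And>s. ((\<lambda>s. p (\<mu> + s *\<^sub>R e)) has_real_derivative h1 s) (at s)"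
    and h2: "\<And>s. (h1 has_real_derivative h2 s) (at s)"
    using twice_differentiable_line[OF assms(4)] by blast
  let ?h = "\<lambda>s. p (\<mu> + s *\<^sub>R e)"
  have h: "?h s = c * \<phi> (s\<^sup>2)" for s by (simp add: p Qe del: bilin_simps)
  have pos: "0 < ?h s" for s using \<phi> \<open>0 < c\<close> by (simp add: h)
  have eq: "(\<lambda>s. g (s\<^sup>2)) = (\<lambda>s. ln (?h s) - ln c)"
  proof
    fix s show "g (s\<^sup>2) = ln (?h s) - ln c"
      using \<phi>[of "s\<^sup>2"] \<open>0 < c\<close> by (simp add: g_def h ln_mult)
  qed
  have 1: "((\<lambda>s. g (s\<^sup>2)) has_real_derivative h1 s / ?h s) (at s)" for s
    unfolding eq using pos[of s] by (auto intro!: derivative_eq_intros h1)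
  have 2: "((\<lambda>s. h1 s / ?h s) has_real_derivative
      (h2 s * ?h s - h1 s * h1 s) / (?h s * ?h s)) (at s)" for s
    by (rule DERIV_divide[OF h2 h1]) (use pos[of s] in simp)
  show "0 \<le> t \<Longrightarrow> (g has_real_derivative halfline_deriv g t) (at t within {0..})"
    and "0 < t \<Longrightarrow> (halfline_deriv g has_real_derivative halfline_deriv (halfline_deriv g) t) (at t)"
    using halfline_deriv_regular[OF 1 2] by blast+
qed

section \<open>The characterisation\<close>

lemma MTP2_elliptical_iff_supermodular:
  assumes "0 < c" and p: "\<And>x. p x = c * \<phi> (quad K (x - \<mu>))"
    and \<phi>: "\<And>x. 0 < \<phi> (quad K x)"
    and "distributed M lborel X (\<lambda>x. ennreal (p x))"
  shows "MTP2 M X p \<longleftrightarrow> supermodular (\<lambda>y. ln (\<phi> (quad K y)))"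
proof -
  have "p a * p b \<le> p a' * p b' \<longleftrightarrow>
      ln (\<phi> (quad K (a - \<mu>))) + ln (\<phi> (quad K (b - \<mu>)))
      \<le> ln (\<phi> (quad K (a' - \<mu>))) + ln (\<phi> (quad K (b' - \<mu>)))" for a b a' b'
  proof -
    have "p a * p b = (c * c) * exp (ln (\<phi> (quad K (a - \<mu>))) + ln (\<phi> (quad K (b - \<mu>))))" for a b
      using \<phi> by (simp add: p exp_add mult_ac del: bilin_simps)
    then show ?thesis using \<open>0 < c\<close> by (simp del: bilin_simps)
  qed
  then have "MTP2 M X p \<longleftrightarrow> supermodular (\<lambda>x. ln (\<phi> (quad K (x - \<mu>))))"
    unfolding MTP2_def supermodular_def using assms(4) by (simp del: bilin_simps)
  then show ?thesis
    using supermodular_translate[of "\<lambda>y. ln (\<phi> (quad K y))" \<mu>] by simp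
qed

theorem theorem4p16:
  fixes M :: "'a measure" and X :: "'a \<Rightarrow> real^'n"
    and \<mu> :: "real^'n" and \<Sigma> :: "real^'n^'n"
    and N :: "'b measure" and \<xi> :: "'b \<Rightarrow> real" and U :: "'b \<Rightarrow> real^'n"
    and \<phi>\<^sub>d :: "real \<Rightarrow> real"
  defines "p \<equiv> elliptical_density \<mu> \<Sigma> \<phi>\<^sub>d"
    and "\<rho> \<equiv> min_partial_corr \<Sigma>"
    and "\<phi>' \<equiv> halfline_deriv (\<lambda>t. ln (\<phi>\<^sub>d t))"
    and "\<phi>'' \<equiv> halfline_deriv (halfline_deriv (\<lambda>t. ln (\<phi>\<^sub>d t)))"
    and "T \<equiv> {t. 0 \<le> t \<and> halfline_deriv (\<lambda>t. ln (\<phi>\<^sub>d t)) t < 0}"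
  assumes "CARD('n) \<ge> 2"
    and "prob_space M"
    and "elliptical M X \<mu> \<Sigma>"
    and "pos_def_matrix \<Sigma>"
    and "stochastic_representation M X \<mu> \<Sigma> N \<xi> U"
    and "integrable N (\<lambda>\<omega>. (\<xi> \<omega>)\<^sup>2)"
    and "0 < (LINT \<omega>|N. (\<xi> \<omega>)\<^sup>2)"
    and "\<And>i j. i \<noteq> j \<Longrightarrow> 0 \<le> partial_corr \<Sigma> i j"
    and "distributed M lborel X (\<lambda>x. ennreal (p x))"
    and "twice_differentiable p"
    and "\<And>t. 0 \<le> t \<Longrightarrow> 0 < \<phi>\<^sub>d t"
  shows "(MTP2 M X p \<longleftrightarrow>
            (\<forall>t\<ge>0. \<phi>' t \<le> 0) \<and>
            (\<forall>t>0. \<phi>' t = 0 \<longrightarrow> \<phi>'' t = 0) \<and>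
            (\<forall>t\<in>T. - (\<rho> / (1 + \<rho>)) \<le> t * \<phi>'' t / \<phi>' t \<and>
                    t * \<phi>'' t / \<phi>' t \<le> \<rho> / (1 - \<rho>))) \<and>
         (MTP2 M X p \<longrightarrow>
            ereal (- 1 / 2) < (INF t\<in>T. ereal (t * \<phi>'' t / \<phi>' t)))"
proof -
  define K where "K = matrix_inv \<Sigma>"
  have K: "pos_def_matrix K"
    unfolding K_def by (rule pos_def_matrix_inverse) fact
  define c where "c = 1 / sqrt (det \<Sigma>)"
  define g where "g = (\<lambda>t. ln (\<phi>\<^sub>d t))"
  have \<phi>': "\<phi>' = halfline_deriv g" and \<phi>'': "\<phi>'' = halfline_deriv \<phi>'"
    and T: "T = {t. 0 \<le> t \<and> \<phi>' t < 0}"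
    by (simp_all add: \<phi>'_def \<phi>''_def T_def g_def)

  have "0 < det \<Sigma>"
  proof -
    (* The square root of \<Sigma> makes the determinant a square. *)
    obtain R where "R ** R = \<Sigma>"
      using assms(10) unfolding stochastic_representation_def by blast
    then have "det \<Sigma> = det R * det R" using det_mul by metis
    moreover have "det \<Sigma> \<noteq> 0"
      using pos_def_matrix_invertible[OF assms(9)] by (simp add: invertible_det_nz)
    ultimately show ?thesis by (simp add: zero_less_mult_iff) (metis linorder_neqE_linordered_idom)
  qed
  then have c: "0 < c" by (simp add: c_def)
  have p: "p x = c * \<phi>\<^sub>d (quad K (x - \<mu>))" for x
    by (simp add: p_def elliptical_density_def c_def K_def bilin_def)
  have pos: "0 < \<phi>\<^sub>d (quad K x)" for x
    using assms(16) pos_def_matrixD(3)[OF K] by blast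
  have g1: "(g has_real_derivative \<phi>' t) (at t within {0..})" if "0 \<le> t" for t
    using elliptical_generator_regular(1)[OF K c p assms(15,16) that] unfolding \<phi>' g_def .
  have g2: "(\<phi>' has_real_derivative \<phi>'' t) (at t)" if "0 < t" for t
    using elliptical_generator_regular(2)[OF K c p assms(15,16) that] unfolding \<phi>'' \<phi>' g_def .
  have MTP2_iff: "MTP2 M X p \<longleftrightarrow> supermodular (\<lambda>y. g (quad K y))"
    unfolding g_def by (rule MTP2_elliptical_iff_supermodular[OF c p pos assms(14)])

  let ?r = "partial_corr \<Sigma>"
  have r_eq: "?r i j = - (K $ i $ j) / sqrt (K $ i $ i * K $ j $ j)" for i j
    by (simp add: partial_corr_def K_def Let_def)
  have sqrt_pos: "0 < sqrt (K $ i $ i * K $ j $ j)" for i j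
    using pos_def_matrix_diag_pos[OF K] by simp
  have r_less_1: "?r i j < 1" if "i \<noteq> j" for i j
    unfolding r_eq divide_less_eq_1_pos[OF sqrt_pos]
    using pos_def_matrix_offdiag_less[OF K that] by linarith
  have K_off: "K $ i $ j \<le> 0" if "i \<noteq> j" for i j
  proof -
    have "0 \<le> - (K $ i $ j) / sqrt (K $ i $ i * K $ j $ j)"
      using assms(13)[OF that] by (simp only: r_eq)
    then show ?thesis using sqrt_pos[of i j] by (simp add: zero_le_divide_iff divide_le_0_iff)
  qed
  have fin: "finite {?r i j | i j. i \<noteq> j}"
    by (rule finite_subset[of _ "case_prod ?r ` UNIV"]) auto
  have "\<not> CARD('n) \<le> Suc 0" using assms(6) by simp
  then obtain i' j' :: 'n where "i' \<noteq> j'"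
    using card_le_Suc0_iff_eq[of "UNIV :: 'n set"] by auto
  then have "{?r i j | i j. i \<noteq> j} \<noteq> {}" by auto
  then have "\<rho> \<in> {?r i j | i j. i \<noteq> j}"
    unfolding \<rho>_def min_partial_corr_def using Min_in[OF fin] by blast
  then obtain i0 j0 where i0j0: "i0 \<noteq> j0" and \<rho>: "\<rho> = ?r i0 j0" by auto
  have \<rho>_le: "\<rho> \<le> ?r i j" if "i \<noteq> j" for i j
    unfolding \<rho>_def min_partial_corr_def by (rule Min_le[OF fin]) (use that in auto)
  have \<rho>01: "0 \<le> \<rho>" "\<rho> < 1"
    using assms(13)[OF i0j0] r_less_1[OF i0j0] by (simp_all add: \<rho>)

  let ?B = "\<lambda>r t. r * \<phi>' t \<le> (1 - r) * (t * \<phi>'' t) \<and> r * \<phi>' t \<le> - ((1 + r) * (t * \<phi>'' t))"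
  have mixed_iff: "(\<forall>y. quad K y = t \<longrightarrow> 0 \<le> \<phi>' t * K $ i $ j
      + 2 * \<phi>'' t * (bilin K (axis i 1) y * bilin K (axis j 1) y)) \<longleftrightarrow> ?B (?r i j) t"
    if "i \<noteq> j" "0 < t" for i j t
    unfolding r_eq by (rule mixed_nonneg_on_ellipsoid_iff[OF K that])

  have nec: "\<forall>t\<ge>0. \<phi>' t \<le> 0" "\<forall>t>0. \<phi>' t = 0 \<longrightarrow> \<phi>'' t = 0"
    "\<forall>t\<in>T. - (\<rho> / (1 + \<rho>)) \<le> t * \<phi>'' t / \<phi>' t \<and> t * \<phi>'' t / \<phi>' t \<le> \<rho> / (1 - \<rho>)"
    if "MTP2 M X p"
  proof -
    have sm: "supermodular (\<lambda>y. g (quad K y))" using that by (simp only: MTP2_iff)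
    have B: "?B \<rho> t" if t: "0 < t" for t
      unfolding \<rho> mixed_iff[OF i0j0 t, symmetric]
    proof (intro allI impI)
      fix y assume y: "quad K y = t"
      then have "y \<noteq> 0" using t by auto
      from supermodular_radial_mixed_nonneg[OF K g1 g2 sm i0j0 this]
      show "0 \<le> \<phi>' t * K $ i0 $ j0
          + 2 * \<phi>'' t * (bilin K (axis i0 1) y * bilin K (axis j0 1) y)"
        by (simp only: y)
    qed
    have neg: "\<phi>' t \<le> 0" if t: "0 < t" for t
    proof (cases "\<rho> = 0")
      case False
      (* The weights cancel the second derivative between the two inequalities of B. *)
      have "(1 + \<rho>) * (\<rho> * \<phi>' t) + (1 - \<rho>) * (\<rho> * \<phi>' t)
          \<le> (1 + \<rho>) * ((1 - \<rho>) * (t * \<phi>'' t)) + (1 - \<rho>) * - ((1 + \<rho>) * (t * \<phi>'' t))"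
        using B[OF t] \<rho>01 by (intro add_mono mult_left_mono) auto
      then have "\<rho> * \<phi>' t \<le> 0" by (simp add: algebra_simps)
      then show ?thesis using \<rho>01 False by (simp add: mult_le_0_iff)
    next
      case True
      (* Here B only says that the second derivative vanishes; that p is a density has to
         exclude a positive slope. *)
      have "\<phi>'' s = 0" if "0 < s" for s
        using B[OF that] that True by (simp add: zero_le_mult_iff mult_le_0_iff)
      then have zero: "(\<phi>' has_real_derivative 0) (at s)" if "0 < s" for s
        using g2[OF that] that by simp
      have const: "\<phi>' s = \<phi>' t" if "0 < s" for s
        by (rule DERIV_isconst3[of 0 "s + t + 1"]) (use that t zero in auto)
      show ?thesis
      proof (rule ccontr)
        assume "\<not> \<phi>' t \<le> 0"
        then have "0 \<le> \<phi>' s" if "0 < s" for s using const[OF that] by simp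
        then have "g 0 \<le> g (quad K y)" for y
          using halfline_mono[OF g1] pos_def_matrixD(3)[OF K] by blast
        then have "\<phi>\<^sub>d 0 \<le> \<phi>\<^sub>d (quad K y)" for y
          unfolding g_def using pos assms(16) by (metis ln_le_cancel_iff order_refl)
        then have "c * \<phi>\<^sub>d 0 \<le> p x" for x
          unfolding p using c by (simp del: bilin_simps)
        moreover have "0 < c * \<phi>\<^sub>d 0" using c assms(16) by simp
        ultimately show False
          using density_not_bounded_below[OF assms(7) assms(14)] by (meson not_less)
      qed
    qed
    have g_le: "g t \<le> g 0" if "0 \<le> t" for t
      using halfline_mono[of "\<lambda>t. - g t" "\<lambda>t. - \<phi>' t" t] g1 neg that
      by (auto intro: derivative_intros)
    (* B is silent at 0; the sign there follows because g decreases on the half-line. *)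
    have "\<phi>' 0 \<le> 0"
    proof (rule ccontr)
      assume "\<not> \<phi>' 0 \<le> 0"
      then obtain d where "d > 0" "\<forall>h>0. 0 + h \<in> {0..} \<longrightarrow> h < d \<longrightarrow> g 0 < g (0 + h)"
        using has_real_derivative_pos_inc_right[OF g1[of 0]] by auto
      then have "g 0 < g (d / 2)" by simp
      with g_le[of "d / 2"] \<open>d > 0\<close> show False by simp
    qed
    with neg show "\<forall>t\<ge>0. \<phi>' t \<le> 0" by (metis order_le_less)
    show "\<forall>t>0. \<phi>' t = 0 \<longrightarrow> \<phi>'' t = 0"
    proof (intro allI impI)
      fix t :: real assume t: "0 < t" and "\<phi>' t = 0"
      with B[OF t] \<rho>01 show "\<phi>'' t = 0"
        by (auto simp: zero_le_mult_iff mult_le_0_iff)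
    qed
    show "\<forall>t\<in>T. - (\<rho> / (1 + \<rho>)) \<le> t * \<phi>'' t / \<phi>' t \<and> t * \<phi>'' t / \<phi>' t \<le> \<rho> / (1 - \<rho>)"
    proof
      fix t assume "t \<in> T"
      then have t: "0 \<le> t" and neg: "\<phi>' t < 0" by (auto simp: T)
      show "- (\<rho> / (1 + \<rho>)) \<le> t * \<phi>'' t / \<phi>' t \<and> t * \<phi>'' t / \<phi>' t \<le> \<rho> / (1 - \<rho>)"
      proof (cases "t = 0")
        case False
        define x where "x = t * \<phi>'' t / \<phi>' t"
        have x: "t * \<phi>'' t = x * \<phi>' t" using neg by (simp add: x_def)
        have "\<rho> * \<phi>' t \<le> ((1 - \<rho>) * x) * \<phi>' t" "\<rho> * \<phi>' t \<le> (- ((1 + \<rho>) * x)) * \<phi>' t"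
          using B[of t] False t by (simp_all add: x)
        then have "(1 - \<rho>) * x \<le> \<rho>" "- ((1 + \<rho>) * x) \<le> \<rho>"
          using neg by (simp_all only: mult_le_cancel_right_neg)
        then show ?thesis
          using \<rho>01 by (simp add: x_def[symmetric] pos_le_divide_eq minus_le_iff
              minus_divide_left pos_divide_le_eq mult.commute del: minus_divide_left[symmetric])
      qed (use \<rho>01 in simp)
    qed
  qed

  have suff: "MTP2 M X p"
    if i: "\<forall>t\<ge>0. \<phi>' t \<le> 0" and ii: "\<forall>t>0. \<phi>' t = 0 \<longrightarrow> \<phi>'' t = 0"
      and iii: "\<forall>t\<in>T. - (\<rho> / (1 + \<rho>)) \<le> t * \<phi>'' t / \<phi>' t \<and> t * \<phi>'' t / \<phi>' t \<le> \<rho> / (1 - \<rho>)"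
    unfolding MTP2_iff
  proof (rule supermodular_radialI[OF K g1 g2 K_off])
    fix i j :: 'n and y :: "real^'n" assume ij: "i \<noteq> j" and "y \<noteq> 0"
    define t where "t = quad K y"
    have t: "0 < t" unfolding t_def by (rule pos_def_matrixD(2)[OF K]) fact
    have "?B (?r i j) t"
    proof (cases "\<phi>' t = 0")
      case True
      then show ?thesis using ii t by simp
    next
      case False
      then have neg: "\<phi>' t < 0" using i t by (metis order_le_less)
      define x where "x = t * \<phi>'' t / \<phi>' t"
      have x: "t * \<phi>'' t = x * \<phi>' t" using neg by (simp add: x_def)
      have r: "\<rho> \<le> ?r i j" "?r i j < 1" using \<rho>_le r_less_1 ij by auto
      have "x \<le> \<rho> / (1 - \<rho>)" "- (\<rho> / (1 + \<rho>)) \<le> x"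
        using iii t neg unfolding x_def T by auto
      (* Both bounds widen as the partial correlation grows, so those for the minimum \<rho>
         imply those for every pair. *)
      moreover have "\<rho> / (1 - \<rho>) \<le> ?r i j / (1 - ?r i j)"
        using r \<rho>01 by (intro frac_le) auto
      moreover have "\<rho> / (1 + \<rho>) \<le> ?r i j / (1 + ?r i j)"
        using r \<rho>01 by (simp add: field_simps)
      ultimately have "x \<le> ?r i j / (1 - ?r i j)" "- x \<le> ?r i j / (1 + ?r i j)" by linarith+
      then have "(1 - ?r i j) * x \<le> ?r i j" "- ((1 + ?r i j) * x) \<le> ?r i j"
        using r \<rho>01 by (simp_all add: pos_le_divide_eq mult.commute)
      then have "?r i j * \<phi>' t \<le> ((1 - ?r i j) * x) * \<phi>' t"
        "?r i j * \<phi>' t \<le> (- ((1 + ?r i j) * x)) * \<phi>' t"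
        using neg by (simp_all only: mult_le_cancel_right_neg)
      then show ?thesis by (simp add: x)
    qed
    then show "0 \<le> \<phi>' (quad K y) * K $ i $ j
        + 2 * \<phi>'' (quad K y) * (bilin K (axis i 1) y * bilin K (axis j 1) y)"
      using mixed_iff[OF ij t] by (metis t_def)
  qed (use i in auto)

  have inf: "ereal (- 1 / 2) < (INF t\<in>T. ereal (t * \<phi>'' t / \<phi>' t))" if "MTP2 M X p"
  proof -
    have "- 1 / 2 < - (\<rho> / (1 + \<rho>))"
      using \<rho>01 by (simp add: divide_less_eq less_divide_eq)
    then have "ereal (- 1 / 2) < ereal (- (\<rho> / (1 + \<rho>)))" by simp
    also have "\<dots> \<le> (INF t\<in>T. ereal (t * \<phi>'' t / \<phi>' t))"
      using nec(3)[OF that] by (intro INF_greatest) auto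
    finally show ?thesis .
  qed
  show ?thesis
    by (intro conjI iffI impI; (elim conjE)?; (erule nec | erule inf | (rule suff; assumption)))
qed

end
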